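(* Let $d\ge 1$, let $\mathbb P\subset S=\mathbf P(H^0(\mathcal O_{\mathbf P^4}(5)))$ be a plane spanned by three non-collinear quintic polynomials $f_0,f_1,f_2$, and let $\mathbb L\subset\mathbb P$ be an open set which satisfies the pencil condition and contains an $S$-generic quintic. Let $\mathbf t=(t_1,\dots,t_{5d+1})$ be generic points of $\mathbf P^1$, let $c_g$ be a generic point of $I_{\mathbb L}$, and let $C_M$ be a system of affine coordinates of $M\simeq\mathbb C^{5d+5}$. Put $f_3=\delta_2f_2+\delta_1f_1+\delta_0f_0$ with $$\delta_2=\left|\begin{array}{cc} f_1(c_g(t_1)) & f_0(c_g(t_1))\\ f_1(c_g(t_2)) & f_0(c_g(t_2))\end{array}\right|,\quad \delta_1=\left|\begin{array}{cc} f_0(c_g(t_1)) & f_2(c_g(t_1))\\ f_0(c_g(t_2)) & f_2(c_g(t_2))\end{array}\right|,\quad \delta_0=\left|\begin{array}{cc} f_2(c_g(t_1)) & f_1(c_g(t_1))\\ f_2(c_g(t_2)) & f_1(c_g(t_2))\end{array}\right| .$$ Then the form $\omega(\mathbb L,\mathbf t)=\bigwedge_{i=3}^{5d+1}\phi_i$, where $$\phi_i=\mathbf d\left|\begin{array}{ccc} f_2(c(t_i)) & f_1(c(t_i)) & f_0(c(t_i))\\ f_2(c(t_1)) & f_1(c(t_1)) & f_0(c(t_1))\\ f_2(c(t_2)) & f_1(c(t_2)) & f_0(c(t_2))\end{array}\right|,$$ is non-vanishing at $c_g$ if the $(5d+5)\times(5d+5)$ matrix $$\mathcal A=\left.\frac{\partial\bigl(f_3(c(t_3)),\dots,f_3(c(t_{5d+1})),\,f_0(c(t_1)),f_1(c(t_1)),f_2(c(t_1)),f_0(c(t_2)),f_1(c(t_2)),f_2(c(t_2))\bigr)}{\partial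 C_M}\right|_{c_g}$$ is non-degenerate. Here the row vectors of $\mathcal A$ represent the differential 1-forms $\mathbf d f_3(c(t_k))|_{c_g}$ ($k=3,\dots,5d+1$) and $\mathbf d f_l(c(t_j))|_{c_g}$ ($l=0,1,2$, $j=1,2$) in $T^*_{c_g}M$, with $f_3$ treated as a fixed polynomial.
   Context: We work over $\mathbb C$ with the Euclidean topology. A generic point of an irreducible analytic (or projective) space means a point in the complement of a proper complex analytic subset; "$S$-generic" means generic in $S$. Let $M=H^0(\mathcal O_{\mathbf P^1}(d))^{\oplus 5}\simeq\mathbb C^{5d+5}$, and let $M_d\subset M$ be the open subset of those $c$ which define a regular map $c:\mathbf P^1\to\mathbf P^4$ that is birational onto its image and whose push-forward cycle has degree $d$. In affine coordinates $c$ is a map $\mathbb C\to\mathbb C^5$, $t_i\in\mathbb C\subset\mathbf P^1$, and a quintic $f$ is a homogeneous polynomial of degree 5 on $\mathbb C^5$, so that $c^*(f)$ is $f(c(t))$; $\mathbf d$ is the differential of functions of $c\in M$. $I_{\mathbb L}$ denotes an irreducible component of the scheme $\{c\in M_d: c^*(f)=0\text{ for some }[f]\in\mathbb L\}$. The pencil condition on $\mathbb L$ requires that all components $I_{\mathbb L}$ be disjoint; in technical terms: for the generic $[f]\in\mathbb L$, a generic rational curve from each irreducible component of $\{c\in M_d:c^*(f)=0\}$ does not lie in any quintic of $\mathbb L$ other than $\mathrm{div}(f)$. For functions $g_1,\dots,g_m$ of $c$, $\partial(g_1,\dots,g_m)/\partial C_M$ denotes the Jacobian matrix, whose rows are the partial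 derivatives of the $g_i$ with respect to the coordinates $C_M$. *)

theory Defs
  imports "HOL-Analysis.Analysis" "Jordan_Normal_Form.Determinant"
begin

section \<open>Complex coordinate spaces, analytic subsets, generic points\<close>

text \<open>For a finite index set \<open>I\<close> the space \<open>\<complex>\<^sup>I\<close> consists of the functions vanishing outside \<open>I\<close>;
  its Euclidean topology is induced by the product topology of the function type.\<close>

definition cspace :: "'i set \<Rightarrow> ('i \<Rightarrow> complex) set" where
  "cspace I = {x. \<forall>i. i \<notin> I \<longrightarrow> x i = 0}"

definition cspace_nz :: "'i set \<Rightarrow> ('i \<Rightarrow> complex) set" where
  "cspace_nz I = cspace I - {\<lambda>_. 0}"

definition open_in_cspace :: "'i set \<Rightarrow> ('i \<Rightarrow> complex) set \<Rightarrow> bool" where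
  "open_in_cspace I U \<longleftrightarrow> openin (top_of_set (cspace I)) U"

text \<open>Holomorphic functions of several variables on an open subset of \<open>\<complex>\<^sup>I\<close>:
  continuous, and holomorphic in each variable separately.\<close>

definition multi_holomorphic_on ::
    "'i set \<Rightarrow> ('i \<Rightarrow> complex) set \<Rightarrow> (('i \<Rightarrow> complex) \<Rightarrow> complex) \<Rightarrow> bool" where
  "multi_holomorphic_on I U g \<longleftrightarrow>
     continuous_on U g \<and>
     (\<forall>x\<in>U. \<forall>i\<in>I. (\<lambda>z. g (x(i := z))) holomorphic_on {z. x(i := z) \<in> U})"

text \<open>\<open>Z\<close> is an analytic subset of \<open>X \<subseteq> \<complex>\<^sup>I\<close>: near every point of \<open>X\<close> it is cut out of \<open>X\<close> by
  finitely many holomorphic functions (in particular it is relatively closed in \<open>X\<close>).\<close>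

definition analytic_subset ::
    "'i set \<Rightarrow> ('i \<Rightarrow> complex) set \<Rightarrow> ('i \<Rightarrow> complex) set \<Rightarrow> bool" where
  "analytic_subset I X Z \<longleftrightarrow>
     Z \<subseteq> X \<and>
     (\<forall>p\<in>X. \<exists>U G. open_in_cspace I U \<and> p \<in> U \<and> finite G \<and>
        (\<forall>g\<in>G. multi_holomorphic_on I U g) \<and>
        Z \<inter> U = {x \<in> X \<inter> U. \<forall>g\<in>G. g x = 0})"

definition irreducible_analytic :: "'i set \<Rightarrow> ('i \<Rightarrow> complex) set \<Rightarrow> bool" where
  "irreducible_analytic I X \<longleftrightarrow>
     X \<noteq> {} \<and>
     (\<forall>A B. analytic_subset I X A \<and> analytic_subset I X B \<and> X = A \<union> B \<longrightarrow> X = A \<or> X = B)"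

definition irreducible_component ::
    "'i set \<Rightarrow> ('i \<Rightarrow> complex) set \<Rightarrow> ('i \<Rightarrow> complex) set \<Rightarrow> bool" where
  "irreducible_component I Y X \<longleftrightarrow>
     analytic_subset I Y X \<and> irreducible_analytic I X \<and>
     (\<forall>X'. analytic_subset I Y X' \<and> irreducible_analytic I X' \<and> X \<subseteq> X' \<longrightarrow> X' = X)"

text \<open>\<open>P\<close> holds for the generic point of the space \<open>\<pi> ` W\<close>, i.e. on the complement of some proper
  analytic subset. The map \<open>\<pi>\<close> is either the identity, or the passage from homogeneous
  coordinates to points of (an open subset of) a projective space or a product of projective
  spaces; in the latter case a set of points is analytic iff its preimage in the space \<open>W\<close> of
  homogeneous coordinates is, because \<open>\<pi>\<close> is a holomorphic submersion.\<close>

definition generically ::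
    "'i set \<Rightarrow> ('i \<Rightarrow> complex) set \<Rightarrow> (('i \<Rightarrow> complex) \<Rightarrow> 'p) \<Rightarrow> ('p \<Rightarrow> bool) \<Rightarrow> bool" where
  "generically I W \<pi> P \<longleftrightarrow>
     (\<exists>Z. Z \<subseteq> \<pi> ` W \<and> analytic_subset I W {w \<in> W. \<pi> w \<in> Z} \<and> Z \<noteq> \<pi> ` W \<and>
        (\<forall>p \<in> \<pi> ` W - Z. P p))"

section \<open>Projective points\<close>

text \<open>The point of projective space with homogeneous coordinates \<open>x\<close> is the line through \<open>x\<close>.\<close>

definition proj_pt :: "('i \<Rightarrow> complex) \<Rightarrow> ('i \<Rightarrow> complex) set" where
  "proj_pt x = {\<lambda>i. z * x i | z. True}"

definition affine_pt :: "complex \<Rightarrow> nat \<Rightarrow> complex" where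
  "affine_pt t = (\<lambda>_. 0)(0 := 1, 1 := t)"

text \<open>\<open>n\<close> generic points \<open>t\<^sub>1, \<dots>, t\<^sub>n\<close> of \<open>\<complex> \<subset> P\<^sup>1\<close>: the tuple is generic in \<open>(P\<^sup>1)\<^sup>n\<close>. The point \<open>i\<close>
  has homogeneous coordinates \<open>\<tau> (i, 0), \<tau> (i, 1)\<close>.\<close>

definition generic_points :: "nat \<Rightarrow> ((nat \<Rightarrow> complex) \<Rightarrow> bool) \<Rightarrow> bool" where
  "generic_points n P \<longleftrightarrow>
     generically ({1..n} \<times> {..<2::nat})
       {\<tau> \<in> cspace ({1..n} \<times> {..<2}). \<forall>i\<in>{1..n}. (\<lambda>j. \<tau> (i, j)) \<noteq> (\<lambda>_. 0)}
       (\<lambda>\<tau>. \<lambda>i\<in>{1..n}. proj_pt (\<lambda>j. \<tau> (i, j)))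
       (\<lambda>p. \<forall>t. p = (\<lambda>i\<in>{1..n}. proj_pt (affine_pt (t i))) \<longrightarrow> P t)"

section \<open>Forms on \<open>\<complex>\<^sup>5\<close> and quintics\<close>

definition exponents :: "nat \<Rightarrow> (nat \<Rightarrow> nat) set" where
  "exponents e = {\<alpha>. (\<forall>l\<ge>5. \<alpha> l = 0) \<and> (\<Sum>l<5. \<alpha> l) = e}"

definition form_eval :: "nat \<Rightarrow> ((nat \<Rightarrow> nat) \<Rightarrow> complex) \<Rightarrow> (nat \<Rightarrow> complex) \<Rightarrow> complex" where
  "form_eval e a x = (\<Sum>\<alpha>\<in>exponents e. a \<alpha> * (\<Prod>l<5. x l ^ \<alpha> l))"

type_synonym quintic = "(nat \<Rightarrow> nat) \<Rightarrow> complex"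

abbreviation quintics :: "quintic set" where
  "quintics \<equiv> cspace (exponents 5)"

definition collinear_quintics :: "quintic \<Rightarrow> quintic \<Rightarrow> quintic \<Rightarrow> bool" where
  "collinear_quintics f\<^sub>0 f\<^sub>1 f\<^sub>2 \<longleftrightarrow>
     (\<exists>g\<in>quintics. \<exists>h\<in>quintics. \<forall>f\<in>{f\<^sub>0, f\<^sub>1, f\<^sub>2}. \<exists>a b. f = (\<lambda>\<alpha>. a * g \<alpha> + b * h \<alpha>))"

definition quintic_span :: "quintic \<Rightarrow> quintic \<Rightarrow> quintic \<Rightarrow> quintic set" where
  "quintic_span f\<^sub>0 f\<^sub>1 f\<^sub>2 = {\<lambda>\<alpha>. a\<^sub>0 * f\<^sub>0 \<alpha> + a\<^sub>1 * f\<^sub>1 \<alpha> + a\<^sub>2 * f\<^sub>2 \<alpha> | a\<^sub>0 a\<^sub>1 a\<^sub>2. True}"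

text \<open>For a set \<open>L\<close> of points of \<open>S\<close>: the quintic polynomials \<open>f\<close> with \<open>[f] \<in> L\<close>.\<close>

definition quintic_cone :: "quintic set set \<Rightarrow> quintic set" where
  "quintic_cone L = {f \<in> cspace_nz (exponents 5). proj_pt f \<in> L}"

text \<open>\<open>L\<close> is an open subset of the projective plane spanned by the three quintics, in the quotient
  topology.\<close>

definition open_in_plane :: "quintic \<Rightarrow> quintic \<Rightarrow> quintic \<Rightarrow> quintic set set \<Rightarrow> bool" where
  "open_in_plane f\<^sub>0 f\<^sub>1 f\<^sub>2 L \<longleftrightarrow>
     L \<subseteq> proj_pt ` (quintic_span f\<^sub>0 f\<^sub>1 f\<^sub>2 - {\<lambda>_. 0}) \<and>
     openin (top_of_set (quintic_span f\<^sub>0 f\<^sub>1 f\<^sub>2 - {\<lambda>_. 0})) (quintic_cone L)"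

section \<open>Parametrized rational curves\<close>

text \<open>\<open>c (l, k)\<close> is the coefficient of \<open>x\<^sub>0\<^bsup>d-k\<^esup> x\<^sub>1\<^bsup>k\<^esup>\<close> in the \<open>l\<close>-th of five binary forms of degree \<open>d\<close>.\<close>

type_synonym param = "nat \<times> nat \<Rightarrow> complex"

abbreviation M_index :: "nat \<Rightarrow> (nat \<times> nat) set" where
  "M_index d \<equiv> {..<5} \<times> {..d}"

abbreviation param_space :: "nat \<Rightarrow> param set" where
  "param_space d \<equiv> cspace (M_index d)"

definition curve :: "nat \<Rightarrow> param \<Rightarrow> (nat \<Rightarrow> complex) \<Rightarrow> nat \<Rightarrow> complex" where
  "curve d c x = (\<lambda>l. \<Sum>k\<le>d. c (l, k) * x 0 ^ (d - k) * x 1 ^ k)"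

definition regular_map :: "nat \<Rightarrow> param \<Rightarrow> bool" where
  "regular_map d c \<longleftrightarrow> (\<forall>x \<in> cspace_nz {..<2}. curve d c x \<noteq> (\<lambda>_. 0))"

text \<open>Birationality onto the image: some rational map \<open>[g\<^sub>0 : g\<^sub>1]\<close> from the image curve to \<open>P\<^sup>1\<close>, given
  by two forms of the same degree which do not both vanish on the image, is inverse to \<open>c\<close>.\<close>

definition birational_onto_image :: "nat \<Rightarrow> param \<Rightarrow> bool" where
  "birational_onto_image d c \<longleftrightarrow>
     (\<exists>e. \<exists>g\<^sub>0 \<in> cspace (exponents e). \<exists>g\<^sub>1 \<in> cspace (exponents e).
        (\<exists>x \<in> cspace_nz {..<2}. form_eval e g\<^sub>0 (curve d c x) \<noteq> 0 \<or> form_eval e g\<^sub>1 (curve d c x) \<noteq> 0) \<and>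
        (\<forall>x \<in> cspace_nz {..<2}. form_eval e g\<^sub>0 (curve d c x) * x 1 = form_eval e g\<^sub>1 (curve d c x) * x 0))"

definition image_curve :: "nat \<Rightarrow> param \<Rightarrow> (nat \<Rightarrow> complex) set set" where
  "image_curve d c = (\<lambda>x. proj_pt (curve d c x)) ` cspace_nz {..<2}"

definition fibre :: "nat \<Rightarrow> param \<Rightarrow> (nat \<Rightarrow> complex) set \<Rightarrow> (nat \<Rightarrow> complex) set set" where
  "fibre d c y = proj_pt ` {x \<in> cspace_nz {..<2}. proj_pt (curve d c x) = y}"

definition hyperplane_section :: "nat \<Rightarrow> param \<Rightarrow> (nat \<Rightarrow> complex) \<Rightarrow> (nat \<Rightarrow> complex) set set" where
  "hyperplane_section d c h = {y \<in> image_curve d c. \<forall>v\<in>y. (\<Sum>l<5. h l * v l) = 0}"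

text \<open>The push-forward cycle is \<open>m\<close> times the image curve, where \<open>m\<close> is the mapping degree (the number
  of points in the general fibre), and the image curve has degree \<open>k\<close>, its number of intersection
  points with a generic hyperplane.\<close>

definition pushforward_cycle_degree :: "nat \<Rightarrow> param \<Rightarrow> nat \<Rightarrow> bool" where
  "pushforward_cycle_degree d c e \<longleftrightarrow>
     (\<exists>m k. e = m * k \<and>
        finite {y \<in> image_curve d c. card (fibre d c y) \<noteq> m} \<and>
        generically {..<5} (cspace_nz {..<5}) proj_pt
          (\<lambda>H. \<forall>h. H = proj_pt h \<longrightarrow> card (hyperplane_section d c h) = k))"

definition M_sub :: "nat \<Rightarrow> param set" where
  "M_sub d = {c \<in> param_space d. regular_map d c \<and> birational_onto_image d c \<and> pushforward_cycle_degree d c d}"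

definition pullback :: "nat \<Rightarrow> quintic \<Rightarrow> param \<Rightarrow> complex \<Rightarrow> complex" where
  "pullback d f c t = form_eval 5 f (curve d c (affine_pt t))"

definition curves_in :: "nat \<Rightarrow> quintic \<Rightarrow> param set" where
  "curves_in d f = {c \<in> M_sub d. \<forall>t. pullback d f c t = 0}"

text \<open>The space whose irreducible components are the \<open>I\<^sub>L\<close>.\<close>

definition curves_in_family :: "nat \<Rightarrow> quintic set set \<Rightarrow> param set" where
  "curves_in_family d L = (\<Union>f \<in> quintic_cone L. curves_in d f)"

definition pencil_condition :: "nat \<Rightarrow> quintic set set \<Rightarrow> bool" where
  "pencil_condition d L \<longleftrightarrow>
     generically (exponents 5) (quintic_cone L) proj_pt
       (\<lambda>q. \<forall>f. q = proj_pt f \<longrightarrow>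
          (\<forall>X. irreducible_component (M_index d) (curves_in d f) X \<longrightarrow>
             generically (M_index d) X id
               (\<lambda>c. \<forall>g \<in> quintic_cone L. c \<in> curves_in d g \<longrightarrow> proj_pt g = q)))"

section \<open>Differential forms on the parameter space\<close>

definition differential :: "(param \<Rightarrow> complex) \<Rightarrow> param \<Rightarrow> param \<Rightarrow> complex" where
  "differential g c = (\<lambda>v. deriv (\<lambda>z. g (\<lambda>i. c i + z * v i)) 0)"

text \<open>The value of \<open>\<psi>\<^sub>0 \<and> \<dots> \<and> \<psi>\<^bsub>n-1\<^esub>\<close> on the tangent vectors \<open>v\<^sub>0, \<dots>, v\<^bsub>n-1\<^esub>\<close>.\<close>

definition wedge :: "nat \<Rightarrow> (nat \<Rightarrow> param \<Rightarrow> complex) \<Rightarrow> (nat \<Rightarrow> param) \<Rightarrow> complex" where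
  "wedge n \<psi> v = Determinant.det (mat n n (\<lambda>(i, j). \<psi> i (v j)))"

definition phi ::
    "nat \<Rightarrow> quintic \<Rightarrow> quintic \<Rightarrow> quintic \<Rightarrow> (nat \<Rightarrow> complex) \<Rightarrow> nat \<Rightarrow> param \<Rightarrow> param \<Rightarrow> complex" where
  "phi d f\<^sub>0 f\<^sub>1 f\<^sub>2 t i = differential (\<lambda>c. Determinant.det (mat_of_rows_list 3
     [[pullback d f\<^sub>2 c (t i), pullback d f\<^sub>1 c (t i), pullback d f\<^sub>0 c (t i)],
      [pullback d f\<^sub>2 c (t 1), pullback d f\<^sub>1 c (t 1), pullback d f\<^sub>0 c (t 1)],
      [pullback d f\<^sub>2 c (t 2), pullback d f\<^sub>1 c (t 2), pullback d f\<^sub>0 c (t 2)]]))"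

text \<open>The \<open>(5d-1)\<close>-form \<open>\<phi>\<^sub>3 \<and> \<dots> \<and> \<phi>\<^bsub>5d+1\<^esub>\<close> at \<open>c\<close>, as an alternating function of tangent vectors.\<close>

definition omega ::
    "nat \<Rightarrow> quintic \<Rightarrow> quintic \<Rightarrow> quintic \<Rightarrow> (nat \<Rightarrow> complex) \<Rightarrow> param \<Rightarrow> (nat \<Rightarrow> param) \<Rightarrow> complex" where
  "omega d f\<^sub>0 f\<^sub>1 f\<^sub>2 t c = wedge (5 * d - 1) (\<lambda>i. phi d f\<^sub>0 f\<^sub>1 f\<^sub>2 t (i + 3) c)"

definition nonvanishing_at ::
    "nat \<Rightarrow> (param \<Rightarrow> (nat \<Rightarrow> param) \<Rightarrow> complex) \<Rightarrow> param \<Rightarrow> bool" where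
  "nonvanishing_at d \<omega> c \<longleftrightarrow> (\<exists>v. (\<forall>i. v i \<in> param_space d) \<and> \<omega> c v \<noteq> 0)"

section \<open>The Jacobian matrix\<close>

definition affine_coordinates :: "nat \<Rightarrow> (param \<Rightarrow> nat \<Rightarrow> complex) \<Rightarrow> bool" where
  "affine_coordinates d C \<longleftrightarrow>
     bij_betw C (param_space d) (cspace {..<5 * d + 5}) \<and>
     (\<forall>x\<in>param_space d. \<forall>y\<in>param_space d. \<forall>z. C (\<lambda>i. (1 - z) * x i + z * y i) = (\<lambda>j. (1 - z) * C x j + z * C y j))"

definition partial_deriv ::
    "nat \<Rightarrow> (param \<Rightarrow> nat \<Rightarrow> complex) \<Rightarrow> nat \<Rightarrow> (param \<Rightarrow> complex) \<Rightarrow> param \<Rightarrow> complex" where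
  "partial_deriv d C j g c = deriv (\<lambda>z. g (inv_into (param_space d) C ((C c)(j := z)))) (C c j)"

definition jacobian ::
    "nat \<Rightarrow> (param \<Rightarrow> nat \<Rightarrow> complex) \<Rightarrow> (param \<Rightarrow> complex) list \<Rightarrow> param \<Rightarrow> complex mat" where
  "jacobian d C gs c = mat (length gs) (5 * d + 5) (\<lambda>(i, j). partial_deriv d C j (gs ! i) c)"

definition det2 :: "complex \<Rightarrow> complex \<Rightarrow> complex \<Rightarrow> complex \<Rightarrow> complex" where
  "det2 a b a' b' = Determinant.det (mat_of_rows_list 2 [[a, b], [a', b']])"

definition f3 ::
    "nat \<Rightarrow> quintic \<Rightarrow> quintic \<Rightarrow> quintic \<Rightarrow> (nat \<Rightarrow> complex) \<Rightarrow> param \<Rightarrow> quintic" where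
  "f3 d f\<^sub>0 f\<^sub>1 f\<^sub>2 t c =
     (let \<delta>\<^sub>2 = det2 (pullback d f\<^sub>1 c (t 1)) (pullback d f\<^sub>0 c (t 1))
                    (pullback d f\<^sub>1 c (t 2)) (pullback d f\<^sub>0 c (t 2));
          \<delta>\<^sub>1 = det2 (pullback d f\<^sub>0 c (t 1)) (pullback d f\<^sub>2 c (t 1))
                    (pullback d f\<^sub>0 c (t 2)) (pullback d f\<^sub>2 c (t 2));
          \<delta>\<^sub>0 = det2 (pullback d f\<^sub>2 c (t 1)) (pullback d f\<^sub>1 c (t 1))
                    (pullback d f\<^sub>2 c (t 2)) (pullback d f\<^sub>1 c (t 2))
      in (\<lambda>\<alpha>. \<delta>\<^sub>2 * f\<^sub>2 \<alpha> + \<delta>\<^sub>1 * f\<^sub>1 \<alpha> + \<delta>\<^sub>0 * f\<^sub>0 \<alpha>))"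

text \<open>The quintic \<open>f3\<close> is formed at the base point \<open>c\<^sub>g\<close> and not differentiated.\<close>

definition matrix_A ::
    "nat \<Rightarrow> quintic \<Rightarrow> quintic \<Rightarrow> quintic \<Rightarrow> (nat \<Rightarrow> complex) \<Rightarrow> (param \<Rightarrow> nat \<Rightarrow> complex) \<Rightarrow> param \<Rightarrow> complex mat" where
  "matrix_A d f\<^sub>0 f\<^sub>1 f\<^sub>2 t C c\<^sub>g =
     jacobian d C
       (map (\<lambda>i c. pullback d (f3 d f\<^sub>0 f\<^sub>1 f\<^sub>2 t c\<^sub>g) c (t i)) [3..<5 * d + 2] @
        [\<lambda>c. pullback d f\<^sub>0 c (t 1), \<lambda>c. pullback d f\<^sub>1 c (t 1), \<lambda>c. pullback d f\<^sub>2 c (t 1),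
         \<lambda>c. pullback d f\<^sub>0 c (t 2), \<lambda>c. pullback d f\<^sub>1 c (t 2), \<lambda>c. pullback d f\<^sub>2 c (t 2)])
       c\<^sub>g"

end

(* With the deltas formed at c, expanding the 3 x 3 determinant along its first row gives
   phi_i = d f_3(c(t_i)) + (a combination of the d f_l(c(t_1)) and d f_l(c(t_2))), so the phi_i agree
   with the first 5d-1 rows of A modulo the last six. If A is invertible, the columns of its inverse
   are tangent vectors dual to the rows of A; on the first 5d-1 of them the matrix of the phi_i is
   the identity. This holds at every point of M, so all genericity conditions hold with empty
   exceptional set. *)

theory Submission
  imports Defs
begin

section \<open>Genericity with empty exceptional set\<close>

text \<open>The empty set is analytic in \<open>W\<close>, as the zero set of the constant 1 on all
  of \<open>cspace I\<close>, and it is proper because \<open>W\<close> is nonempty.\<close>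

lemma generically_everywhere:
  assumes "W \<subseteq> cspace I" "W \<noteq> {}" "\<And>w. w \<in> W \<Longrightarrow> P (\<pi> w)"
  shows "generically I W \<pi> P"
proof -
  have "analytic_subset I W {}"
    unfolding analytic_subset_def
  proof (intro conjI ballI)
    fix p assume "p \<in> W"
    with assms(1) have "p \<in> cspace I" by blast
    moreover have "multi_holomorphic_on I (cspace I) (\<lambda>_. 1)"
      unfolding multi_holomorphic_on_def by auto
    ultimately show "\<exists>U G. open_in_cspace I U \<and> p \<in> U \<and> finite G \<and>
        (\<forall>g\<in>G. multi_holomorphic_on I U g) \<and> {} \<inter> U = {x \<in> W \<inter> U. \<forall>g\<in>G. g x = 0}"
      by (intro exI[of _ "cspace I"] exI[of _ "{\<lambda>_. 1}"]) (auto simp: open_in_cspace_def)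
  qed simp
  then show ?thesis
    unfolding generically_def using assms(2,3) by (intro exI[of _ "{}"]) auto
qed

section \<open>Differentials of the values of a quintic along a curve\<close>

lemma curve_line: "curve d (\<lambda>i. c i + z * v i) x = (\<lambda>l. curve d c x l + z * curve d v x l)"
  by (simp add: curve_def fun_eq_iff algebra_simps sum.distrib sum_distrib_left)

lemma curve_sum: "curve d (\<lambda>i. \<Sum>j\<in>J. b j * w j i) x l = (\<Sum>j\<in>J. b j * curve d (w j) x l)"
proof -
  have "curve d (\<lambda>i. \<Sum>j\<in>J. b j * w j i) x l =
      (\<Sum>k\<le>d. \<Sum>j\<in>J. b j * (w j (l, k) * x 0 ^ (d - k) * x 1 ^ k))"
    by (simp add: curve_def sum_distrib_left sum_distrib_right mult_ac)
  also have "\<dots> = (\<Sum>j\<in>J. b j * curve d (w j) x l)"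
    by (subst sum.swap) (simp add: curve_def sum_distrib_left)
  finally show ?thesis .
qed

text \<open>The partial derivative of the form in direction \<open>l\<close>, monomial by monomial.
  If \<open>\<alpha> l = 0\<close>, the truncated exponent \<open>\<alpha> l - 1\<close> is
  harmless, since the factor \<open>of_nat (\<alpha> l)\<close> vanishes.\<close>

definition form_gradient :: "nat \<Rightarrow> ((nat \<Rightarrow> nat) \<Rightarrow> complex) \<Rightarrow> (nat \<Rightarrow> complex) \<Rightarrow> nat \<Rightarrow> complex" where
  "form_gradient e a x l = (\<Sum>\<alpha>\<in>exponents e.
     a \<alpha> * (of_nat (\<alpha> l) * x l ^ (\<alpha> l - 1) * (\<Prod>m\<in>{..<5} - {l}. x m ^ \<alpha> m)))"

lemma form_eval_line_derivative:
  "((\<lambda>z. form_eval e a (\<lambda>l. x l + z * y l)) has_field_derivative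
     (\<Sum>l<5. form_gradient e a x l * y l)) (at 0)"
proof -
  have pow: "((\<lambda>z. (x l + z * y l) ^ n) has_field_derivative
      of_nat n * x l ^ (n - 1) * y l) (at 0)" for l n
    by (auto intro!: derivative_eq_intros simp: mult_ac)
  have monomial: "((\<lambda>z. \<Prod>l<5. (x l + z * y l) ^ \<alpha> l) has_field_derivative
      (\<Sum>l<5. of_nat (\<alpha> l) * x l ^ (\<alpha> l - 1) * y l * (\<Prod>m\<in>{..<5} - {l}. x m ^ \<alpha> m))) (at 0)"
    for \<alpha> :: "nat \<Rightarrow> nat"
    by (rule has_field_derivative_prod[THEN DERIV_cong], rule pow, simp)
  have "((\<lambda>z. form_eval e a (\<lambda>l. x l + z * y l)) has_field_derivative
     (\<Sum>\<alpha>\<in>exponents e. a \<alpha> *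
        (\<Sum>l<5. of_nat (\<alpha> l) * x l ^ (\<alpha> l - 1) * y l * (\<Prod>m\<in>{..<5} - {l}. x m ^ \<alpha> m)))) (at 0)"
    unfolding form_eval_def by (intro DERIV_sum DERIV_cmult monomial)
  also have "(\<Sum>\<alpha>\<in>exponents e. a \<alpha> *
        (\<Sum>l<5. of_nat (\<alpha> l) * x l ^ (\<alpha> l - 1) * y l * (\<Prod>m\<in>{..<5} - {l}. x m ^ \<alpha> m)))
      = (\<Sum>l<5. form_gradient e a x l * y l)"
    unfolding form_gradient_def sum_distrib_left sum_distrib_right
    \<comment> \<open>The derivative comes sorted by monomials; the gradient sorts it by
      coordinates.\<close>
    by (subst sum.swap) (simp add: mult_ac)
  finally show ?thesis .
qed

lemma pullback_line_derivative:
  "((\<lambda>z. pullback d f (\<lambda>i. c i + z * v i) t) has_field_derivative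
     (\<Sum>l<5. form_gradient 5 f (curve d c (affine_pt t)) l * curve d v (affine_pt t) l)) (at 0)"
  unfolding pullback_def curve_line by (rule form_eval_line_derivative)

text \<open>The chain rule: \<open>curve\<close> is linear in its coefficients, so a line in the
  parameter space moves each point of the curve along a line. The formula makes linearity in
  \<open>v\<close> visible.\<close>

lemma differential_pullback:
  "differential (\<lambda>c. pullback d f c t) c v =
     (\<Sum>l<5. form_gradient 5 f (curve d c (affine_pt t)) l * curve d v (affine_pt t) l)"
  unfolding differential_def by (rule DERIV_imp_deriv[OF pullback_line_derivative])

lemma has_differential_pullback:
  "((\<lambda>z. pullback d f (\<lambda>i. c i + z * v i) t) has_field_derivative
     differential (\<lambda>c. pullback d f c t) c v) (at 0)"
  unfolding differential_pullback by (rule pullback_line_derivative)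

text \<open>Needed because the dual tangent vectors are combinations of coordinate
  directions.\<close>

lemma differential_pullback_sum:
  "differential (\<lambda>c. pullback d f c t) c (\<lambda>i. \<Sum>j\<in>J. b j * w j i) =
     (\<Sum>j\<in>J. b j * differential (\<lambda>c. pullback d f c t) c (w j))"
  unfolding differential_pullback curve_sum sum_distrib_left
  by (subst sum.swap) (simp add: mult_ac)

lemma pullback_lincomb3:
  "pullback d (\<lambda>\<alpha>. p * f \<alpha> + q * g \<alpha> + r * h \<alpha>) c s =
     p * pullback d f c s + q * pullback d g c s + r * pullback d h c s"
  by (simp add: pullback_def form_eval_def algebra_simps sum.distrib sum_distrib_left)

lemma differential_pullback_lincomb3:
  "differential (\<lambda>c. pullback d (\<lambda>\<alpha>. p * f \<alpha> + q * g \<alpha> + r * h \<alpha>) c s) c v =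
     p * differential (\<lambda>c. pullback d f c s) c v + q * differential (\<lambda>c. pullback d g c s) c v +
     r * differential (\<lambda>c. pullback d h c s) c v"
  \<comment> \<open>This instance matches only the differential of a sum, so the three differentials
    on the right stay folded.\<close>
  unfolding pullback_lincomb3 differential_def[of "\<lambda>c. _ c + _ c"]
  by (rule DERIV_imp_deriv) (intro DERIV_add DERIV_cmult has_differential_pullback)

section \<open>Determinants of order two and three\<close>

lemma det_carrier_2:
  fixes A :: "'a :: comm_ring_1 mat"
  assumes A: "A \<in> carrier_mat 2 2"
  shows "Determinant.det A = A $$ (0, 0) * A $$ (1, 1) - A $$ (0, 1) * A $$ (1, 0)"
proof -
  have minor: "Determinant.det (mat_delete A i j) = mat_delete A i j $$ (0, 0)" for i j
    by (rule det_single) (use A in auto)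
  show ?thesis
    using A unfolding laplace_expansion_row[OF A zero_less_numeral] cofactor_def minor
    by (simp add: mat_delete_def numeral_2_eq_2)
qed

lemma det2_eq: "det2 a b a' b' = a * b' - b * a'"
  unfolding det2_def by (subst det_carrier_2) (auto simp: mat_of_rows_list_def)

text \<open>Laplace expansion along the first row. The middle minor absorbs the sign of its cofactor
  by a swap of columns, so the three coefficients have the shape of \<open>\<delta>\<^sub>2\<close>,
  \<open>\<delta>\<^sub>1\<close>, \<open>\<delta>\<^sub>0\<close> in \<open>f3\<close>.\<close>

lemma det3_eq:
  "Determinant.det (mat_of_rows_list 3 [[a\<^sub>2, a\<^sub>1, a\<^sub>0], [b\<^sub>2, b\<^sub>1, b\<^sub>0], [c\<^sub>2, c\<^sub>1, c\<^sub>0 :: 'a :: comm_ring_1]]) =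
     a\<^sub>2 * (b\<^sub>1 * c\<^sub>0 - b\<^sub>0 * c\<^sub>1) + a\<^sub>1 * (b\<^sub>0 * c\<^sub>2 - b\<^sub>2 * c\<^sub>0) + a\<^sub>0 * (b\<^sub>2 * c\<^sub>1 - b\<^sub>1 * c\<^sub>2)"
proof -
  define A where "A = mat_of_rows_list 3 [[a\<^sub>2, a\<^sub>1, a\<^sub>0], [b\<^sub>2, b\<^sub>1, b\<^sub>0], [c\<^sub>2, c\<^sub>1, c\<^sub>0]]"
  have A: "A \<in> carrier_mat 3 3" by (auto simp: A_def mat_of_rows_list_def)
  have minor: "Determinant.det (mat_delete A 0 j) =
      mat_delete A 0 j $$ (0, 0) * mat_delete A 0 j $$ (1, 1) -
      mat_delete A 0 j $$ (0, 1) * mat_delete A 0 j $$ (1, 0)" for j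
    by (rule det_carrier_2) (use A in auto)
  have "Determinant.det A = (\<Sum>j<3. A $$ (0, j) * cofactor A 0 j)"
    using laplace_expansion_row[OF A, of 0] by simp
  then show ?thesis
    unfolding A_def[symmetric] cofactor_def minor
    by (simp add: mat_delete_def A_def mat_of_rows_list_def numeral_3_eq_3 algebra_simps)
qed

section \<open>Comparison of \<open>phi\<close> with the differentials of \<open>f3\<close>\<close>

text \<open>If \<open>v\<close> is killed by the six differentials at \<open>t 1\<close> and
  \<open>t 2\<close>, the product rule leaves only the derivative of the first row, with the minors
  frozen at \<open>c\<close>; these are the coefficients of \<open>f3\<close>.\<close>

lemma phi_eq_differential_f3:
  assumes "\<And>f s. f \<in> {f\<^sub>0, f\<^sub>1, f\<^sub>2} \<Longrightarrow> s \<in> {t 1, t 2} \<Longrightarrow> differential (\<lambda>c. pullback d f c s) c v = 0"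
  shows "phi d f\<^sub>0 f\<^sub>1 f\<^sub>2 t i c v = differential (\<lambda>c'. pullback d (f3 d f\<^sub>0 f\<^sub>1 f\<^sub>2 t c) c' (t i)) c v"
proof -
  let ?D = "\<lambda>f. differential (\<lambda>c. pullback d f c (t i)) c v"
  let ?p = "\<lambda>f k z. pullback d f (\<lambda>i. c i + z * v i) (t k)"
  have zero: "(?p f k has_field_derivative 0) (at 0)"
    if "f \<in> {f\<^sub>0, f\<^sub>1, f\<^sub>2}" "k \<in> {1, 2}" for f k
    using has_differential_pullback[of d f c v "t k"] assms[of f "t k"] that by auto
  have minor: "((\<lambda>z. ?p f 1 z * ?p g 2 z - ?p g 1 z * ?p f 2 z) has_field_derivative 0) (at 0)"
    if "f \<in> {f\<^sub>0, f\<^sub>1, f\<^sub>2}" "g \<in> {f\<^sub>0, f\<^sub>1, f\<^sub>2}" for f g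
    by (rule DERIV_cong[OF DERIV_diff[OF DERIV_mult[OF zero[of f 1] zero[of g 2]]
          DERIV_mult[OF zero[of g 1] zero[of f 2]]]]) (use that in simp_all)
  \<comment> \<open>One statement covers all three terms of the expansion, with
    \<open>(f, g)\<close> equal to \<open>(f\<^sub>1, f\<^sub>0)\<close>,
    \<open>(f\<^sub>0, f\<^sub>2)\<close> and \<open>(f\<^sub>2, f\<^sub>1)\<close>.\<close>
  have cofactor_term: "((\<lambda>z. ?p h i z * (?p f 1 z * ?p g 2 z - ?p g 1 z * ?p f 2 z)) has_field_derivative
      (pullback d f c (t 1) * pullback d g c (t 2) - pullback d g c (t 1) * pullback d f c (t 2)) * ?D h) (at 0)"
    if "f \<in> {f\<^sub>0, f\<^sub>1, f\<^sub>2}" "g \<in> {f\<^sub>0, f\<^sub>1, f\<^sub>2}" for f g h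
    by (rule DERIV_cong[OF DERIV_mult[OF has_differential_pullback[of d h c v "t i"] minor[OF that]]])
      (simp add: mult.commute)
  show ?thesis
    unfolding phi_def f3_def Let_def differential_pullback_lincomb3 det3_eq det2_eq
      differential_def[of "\<lambda>c. _ c + _ c"]
    by (rule DERIV_imp_deriv) (intro DERIV_add cofactor_term; simp)
qed

text \<open>The inverse of an affine bijection is affine, so coordinate lines through
  \<open>c\<close> are straight lines, and partial derivatives are derivatives in fixed directions,
  for arbitrary \<open>g\<close>.\<close>

lemma affine_coordinate_directions:
  assumes C: "affine_coordinates d C" and c: "c \<in> param_space d"
  obtains w where "\<And>j. j < 5 * d + 5 \<Longrightarrow> w j \<in> param_space d"
    "\<And>j g. j < 5 * d + 5 \<Longrightarrow> partial_deriv d C j g c = differential g c (w j)"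
proof -
  let ?e = "\<lambda>j z. (C c)(j := z)"
  let ?inv = "inv_into (param_space d) C"
  \<comment> \<open>The displacement that raises the coordinate \<open>j\<close> by 1.\<close>
  define w where "w j = (\<lambda>i. ?inv (?e j (C c j + 1)) i - c i)" for j
  have bij: "bij_betw C (param_space d) (cspace {..<5 * d + 5})"
    and aff: "\<And>x y z. x \<in> param_space d \<Longrightarrow> y \<in> param_space d \<Longrightarrow>
      C (\<lambda>i. (1 - z) * x i + z * y i) = (\<lambda>j. (1 - z) * C x j + z * C y j)"
    using C by (auto simp: affine_coordinates_def)
  have Cc: "?e j z \<in> cspace {..<5 * d + 5}" if "j < 5 * d + 5" for j z
    using bij_betwE[OF bij] c that by (auto simp: cspace_def)
  have y: "?inv (?e j z) \<in> param_space d" "C (?inv (?e j z)) = ?e j z" if "j < 5 * d + 5" for j z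
    using Cc[OF that] bij bij_betw_inv_into[OF bij]
    by (auto simp: bij_betw_inv_into_right dest: bij_betwE)
  have line: "?inv (?e j (C c j + z)) = (\<lambda>i. c i + z * w j i)" if j: "j < 5 * d + 5" for j z
  proof -
    let ?y = "?inv (?e j (C c j + 1))"
    have mem: "(\<lambda>i. (1 - z) * c i + z * ?y i) \<in> param_space d"
      using c y(1)[OF j, of "C c j + 1"] by (auto simp: cspace_def)
    \<comment> \<open>The point at parameter \<open>z\<close> on the line from \<open>c\<close> to
      \<open>?y\<close> has the required coordinates; injectivity of \<open>C\<close> identifies it
      with the inverse image.\<close>
    have "C (\<lambda>i. (1 - z) * c i + z * ?y i) = ?e j (C c j + z)"
      unfolding aff[OF c y(1)[OF j]] y(2)[OF j] by (auto simp: fun_eq_iff algebra_simps)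
    then have "?inv (?e j (C c j + z)) = (\<lambda>i. (1 - z) * c i + z * ?y i)"
      using bij_betw_inv_into_left[OF bij mem] by simp
    then show ?thesis by (auto simp: w_def fun_eq_iff algebra_simps)
  qed
  show thesis
  proof
    show "w j \<in> param_space d" if "j < 5 * d + 5" for j
      using y(1)[OF that, of "C c j + 1"] c by (auto simp: w_def cspace_def)
    show "partial_deriv d C j g c = differential g c (w j)" if "j < 5 * d + 5" for j g
      unfolding partial_deriv_def differential_def
      by (subst deriv_shift_0) (simp add: o_def line[OF that])
  qed
qed

section \<open>Tangent vectors dual to the rows of the Jacobian matrix\<close>

lemma nonvanishing_omega:
  assumes d: "d \<ge> 1" and c: "c \<in> param_space d" and C: "affine_coordinates d C"
    and nz: "Determinant.det (matrix_A d f\<^sub>0 f\<^sub>1 f\<^sub>2 t C c) \<noteq> 0"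
  shows "nonvanishing_at d (omega d f\<^sub>0 f\<^sub>1 f\<^sub>2 t) c"
proof -
  let ?N = "5 * d + 5" and ?n = "5 * d - 1"
  define A where "A = matrix_A d f\<^sub>0 f\<^sub>1 f\<^sub>2 t C c"
  define F where "F = f3 d f\<^sub>0 f\<^sub>1 f\<^sub>2 t c"
  define fs where "fs = map (\<lambda>i c. pullback d F c (t i)) [3..<5 * d + 2]"
  define hs where "hs = [\<lambda>c. pullback d f\<^sub>0 c (t 1), \<lambda>c. pullback d f\<^sub>1 c (t 1), \<lambda>c. pullback d f\<^sub>2 c (t 1),
         \<lambda>c. pullback d f\<^sub>0 c (t 2), \<lambda>c. pullback d f\<^sub>1 c (t 2), \<lambda>c. pullback d f\<^sub>2 c (t 2)]"
  have A_eq: "A = jacobian d C (fs @ hs) c"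
    by (simp add: A_def matrix_A_def fs_def hs_def F_def)
  have len: "length fs = ?n" "length hs = 6" "length (fs @ hs) = ?N"
    using d by (auto simp: fs_def hs_def)
  have A: "A \<in> carrier_mat ?N ?N"
    unfolding A_eq jacobian_def len by simp
  obtain w where w: "\<And>j. j < ?N \<Longrightarrow> w j \<in> param_space d"
    "\<And>j g. j < ?N \<Longrightarrow> partial_deriv d C j g c = differential g c (w j)"
    using affine_coordinate_directions[OF C c] by metis
  have "Determinant.det A \<noteq> 0" using nz by (simp add: A_def)
  from det_non_zero_imp_unit[OF A this] obtain B where B: "B \<in> carrier_mat ?N ?N" "A * B = 1\<^sub>m ?N"
    unfolding Units_def ring_mat_def by auto
  \<comment> \<open>Column \<open>k\<close> of the inverse, read as coefficients with respect to the
    directions \<open>w j\<close>.\<close>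
  define v where "v k = (\<lambda>i. \<Sum>j<?N. B $$ (j, k) * w j i)" for k
  \<comment> \<open>\<open>nonvanishing_at\<close> asks for membership at every index, also beyond
    the columns of \<open>B\<close>.\<close>
  have v_mem: "v k \<in> param_space d" for k
    using w(1) by (auto simp: v_def cspace_def intro!: sum.neutral)
  have dual: "differential ((fs @ hs) ! i) c (v k) = (if i = k then 1 else 0)"
    if ik: "i < ?N" "k < ?N" for i k
  proof -
    \<comment> \<open>Every row is the differential of some \<open>pullback\<close>, hence linear in
      the tangent vector.\<close>
    have "\<exists>f s. g = (\<lambda>c. pullback d f c s)" if "g \<in> set (fs @ hs)" for g
      using that by (auto simp: fs_def hs_def)
    then obtain f s where fs: "(fs @ hs) ! i = (\<lambda>c. pullback d f c s)"
      using nth_mem[of i "fs @ hs"] ik(1) unfolding len by metis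
    have "(if i = k then 1 else 0) = (A * B) $$ (i, k)"
      using ik by (simp add: B(2))
    also have "\<dots> = (\<Sum>j<?N. A $$ (i, j) * B $$ (j, k))"
      using A B(1) ik by (simp add: scalar_prod_def atLeast0LessThan)
    also have "\<dots> = (\<Sum>j<?N. B $$ (j, k) * differential ((fs @ hs) ! i) c (w j))"
      using ik(1) w(2) unfolding A_eq jacobian_def len(3) by (simp add: mult.commute)
    also have "\<dots> = differential ((fs @ hs) ! i) c (v k)"
      unfolding fs v_def differential_pullback_sum ..
    finally show ?thesis by simp
  qed
  \<comment> \<open>The last six rows have index at least \<open>?n > k\<close>, so duality gives 0.
    This is the hypothesis under which \<open>phi\<close> agrees with the differential of
    \<open>f3\<close>.\<close>
  have kill: "differential h c (v k) = 0" if h_mem: "h \<in> set hs" and k: "k < ?n" for h k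
  proof -
    obtain r where r: "r < 6" "h = hs ! r"
      using h_mem unfolding in_set_conv_nth len(2) by blast
    have h: "h = (fs @ hs) ! (?n + r)"
      using nth_append_length_plus[of fs hs r] unfolding len(1) r(2) by (rule sym)
    have "?n + r < ?N" "k < ?N" "?n + r \<noteq> k"
      using r(1) k d by linarith+
    then show ?thesis
      unfolding h using dual[of "?n + r" k] by simp
  qed
  have "phi d f\<^sub>0 f\<^sub>1 f\<^sub>2 t (i + 3) c (v k) = (if i = k then 1 else 0)" if ik: "i < ?n" "k < ?n" for i k
  proof -
    have "phi d f\<^sub>0 f\<^sub>1 f\<^sub>2 t (i + 3) c (v k) = differential (\<lambda>c'. pullback d F c' (t (i + 3))) c (v k)"
      unfolding F_def
      by (rule phi_eq_differential_f3, rule kill[OF _ ik(2)]) (auto simp: hs_def)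
    \<comment> \<open>The first block of rows starts at the point \<open>t 3\<close>, whence the
      shift by 3.\<close>
    also have "(\<lambda>c'. pullback d F c' (t (i + 3))) = (fs @ hs) ! i"
      unfolding nth_append_left[of i fs hs, unfolded len(1), OF ik(1)] unfolding fs_def
      using ik(1) by (subst nth_map) (simp_all add: add.commute del: upt_Suc)
    finally show ?thesis using dual[of i k] ik by simp
  qed
  then have "mat ?n ?n (\<lambda>(i, j). phi d f\<^sub>0 f\<^sub>1 f\<^sub>2 t (i + 3) c (v j)) = 1\<^sub>m ?n"
    by (intro eq_matI) auto
  then have "omega d f\<^sub>0 f\<^sub>1 f\<^sub>2 t c v = 1"
    by (simp add: omega_def wedge_def)
  then show ?thesis
    unfolding nonvanishing_at_def using v_mem by (intro exI[of _ v]) auto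
qed

section \<open>Nested genericity quantifiers\<close>

theorem proposition1p6:
  fixes d :: nat
  assumes "d \<ge> 1"
  shows
    "generically (exponents 5) (cspace_nz (exponents 5)) proj_pt (\<lambda>q.
       \<forall>f\<^sub>0\<in>quintics. \<forall>f\<^sub>1\<in>quintics. \<forall>f\<^sub>2\<in>quintics. \<forall>L.
         \<not> collinear_quintics f\<^sub>0 f\<^sub>1 f\<^sub>2 \<and> open_in_plane f\<^sub>0 f\<^sub>1 f\<^sub>2 L \<and>
         pencil_condition d L \<and> q \<in> L \<longrightarrow>
         generic_points (5 * d + 1) (\<lambda>t.
           \<forall>X. irreducible_component (M_index d) (curves_in_family d L) X \<longrightarrow>
             generically (M_index d) X id (\<lambda>c\<^sub>g.
               \<forall>C. affine_coordinates d C \<longrightarrow>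
                 Determinant.det (matrix_A d f\<^sub>0 f\<^sub>1 f\<^sub>2 t C c\<^sub>g) \<noteq> 0 \<longrightarrow>
                 nonvanishing_at d (omega d f\<^sub>0 f\<^sub>1 f\<^sub>2 t) c\<^sub>g)))"
proof -
  have component: "generically (M_index d) X id (\<lambda>c\<^sub>g. \<forall>C. affine_coordinates d C \<longrightarrow>
      Determinant.det (matrix_A d f\<^sub>0 f\<^sub>1 f\<^sub>2 t C c\<^sub>g) \<noteq> 0 \<longrightarrow> nonvanishing_at d (omega d f\<^sub>0 f\<^sub>1 f\<^sub>2 t) c\<^sub>g)"
    if "irreducible_component (M_index d) (curves_in_family d L) X" for f\<^sub>0 f\<^sub>1 f\<^sub>2 L t X
  proof -
    \<comment> \<open>An empty exceptional set is proper only in a nonempty space; irreducibility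
      includes nonemptiness.\<close>
    have "X \<noteq> {}" "X \<subseteq> curves_in_family d L"
      using that by (auto simp: irreducible_component_def irreducible_analytic_def analytic_subset_def)
    moreover have "curves_in_family d L \<subseteq> param_space d"
      by (auto simp: curves_in_family_def curves_in_def M_sub_def)
    ultimately show ?thesis
      using nonvanishing_omega[OF assms] by (intro generically_everywhere) auto
  qed
  have points: "generic_points n P" if "\<And>t. P t" for n P
    unfolding generic_points_def
  proof (rule generically_everywhere)
    let ?W = "{\<tau> \<in> cspace ({1..n} \<times> {..<2::nat}). \<forall>i\<in>{1..n}. (\<lambda>j. \<tau> (i, j)) \<noteq> (\<lambda>_. 0)}"
    \<comment> \<open>All homogeneous coordinates are 1, so each of the \<open>n\<close> points is
      [1:1].\<close>
    let ?\<tau> = "\<lambda>p. if p \<in> {1..n} \<times> {..<2::nat} then 1 else 0 :: complex"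
    have "?\<tau> \<in> cspace ({1..n} \<times> {..<2})"
      by (simp add: cspace_def)
    moreover have "(\<lambda>j. ?\<tau> (i, j)) \<noteq> (\<lambda>_. 0)" if "i \<in> {1..n}" for i
    proof
      assume "(\<lambda>j. ?\<tau> (i, j)) = (\<lambda>_. 0)"
      from fun_cong[OF this, of 0] that show False by simp
    qed
    ultimately have "?\<tau> \<in> ?W" by blast
    then show "?W \<noteq> {}" by blast
  qed (auto simp: that)
  \<comment> \<open>The fifth power of the first coordinate is one quintic monomial, so the sum of
    all quintic monomials is a nonzero quintic.\<close>
  have "(\<lambda>_. 0)(0 := 5) \<in> exponents 5"
    by (auto simp: exponents_def)
  then have "(\<lambda>\<alpha>. if \<alpha> \<in> exponents 5 then 1 else 0) \<in> cspace_nz (exponents 5)"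
    by (auto simp: cspace_nz_def cspace_def fun_eq_iff)
  then have nonempty: "cspace_nz (exponents 5) \<noteq> {}"
    by blast
  show ?thesis
  proof (rule generically_everywhere[OF _ nonempty])
    show "cspace_nz (exponents 5) \<subseteq> cspace (exponents 5)"
      by (auto simp: cspace_nz_def)
  next
    fix w :: quintic
    show "\<forall>f\<^sub>0\<in>quintics. \<forall>f\<^sub>1\<in>quintics. \<forall>f\<^sub>2\<in>quintics. \<forall>L.
         \<not> collinear_quintics f\<^sub>0 f\<^sub>1 f\<^sub>2 \<and> open_in_plane f\<^sub>0 f\<^sub>1 f\<^sub>2 L \<and>
         pencil_condition d L \<and> proj_pt w \<in> L \<longrightarrow>
         generic_points (5 * d + 1) (\<lambda>t.
           \<forall>X. irreducible_component (M_index d) (curves_in_family d L) X \<longrightarrow>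
             generically (M_index d) X id (\<lambda>c\<^sub>g.
               \<forall>C. affine_coordinates d C \<longrightarrow>
                 Determinant.det (matrix_A d f\<^sub>0 f\<^sub>1 f\<^sub>2 t C c\<^sub>g) \<noteq> 0 \<longrightarrow>
                 nonvanishing_at d (omega d f\<^sub>0 f\<^sub>1 f\<^sub>2 t) c\<^sub>g))"
      by (intro ballI allI impI points) (rule component)
  qed
qed

end
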